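(* Let $R$ be a commutative Noetherian semiring and let $I$ be a $k$-ideal of $R$. Then $I$ can be represented as a finite intersection $I=\bigcap_{i=1}^n Q_i$ of primary ideals $Q_i$ of $R$; that is, $I$ has a reduced primary decomposition.
   Context: A semiring is a set $R$ with addition and multiplication such that $(R,+)$ is a commutative monoid with identity $0$, $(R,\cdot)$ is a monoid with identity $1$, multiplication distributes over addition on both sides, $0\cdot r=0=r\cdot 0$ for all $r$, and $1\neq 0$. $R$ is commutative if $(R,\cdot)$ is commutative. An ideal of $R$ is a nonempty subset closed under addition and under multiplication by arbitrary elements of $R$. $R$ is Noetherian if it satisfies the ascending chain condition on ideals. An ideal $I$ is a $k$-ideal if $x+y\in I$ and $x\in I$ imply $y\in I$. The radical of an ideal $I$ is $\sqrt{I}=\{a\in R\mid a^n\in I \text{ for some } n\ge 1\}$. A proper ideal $Q$ is primary if $xy\in Q$ implies $x\in Q$ or $y\in\sqrt{Q}$. A primary decomposition $I=\bigcap_{i=1}^n Q_i$ (each $Q_i$ primary, $P_i=\sqrt{Q_i}$) is reduced if the $P_i$ are pairwise distinct and $I$ is not the intersection of any proper subfamily of the $Q_i$. (The empty intersection is understood as $R$.) *)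

theory Defs
  imports Main
begin

text \<open>Semirings in the sense of the paper are modelled by the type class comm_semiring_1
  (commutative additive monoid, commutative multiplicative monoid, distributivity,
  0 absorbing, 0 \<noteq> 1). The semiring R is the whole type.\<close>

definition sr_ideal :: "'a::comm_semiring_1 set \<Rightarrow> bool" where
  "sr_ideal I \<longleftrightarrow> I \<noteq> {} \<and> (\<forall>x\<in>I. \<forall>y\<in>I. x + y \<in> I) \<and> (\<forall>r. \<forall>x\<in>I. r * x \<in> I \<and> x * r \<in> I)"

definition noetherian_semiring :: "'a::comm_semiring_1 itself \<Rightarrow> bool" where
  "noetherian_semiring _ \<longleftrightarrow>
     (\<forall>f :: nat \<Rightarrow> 'a set. (\<forall>n. sr_ideal (f n)) \<and> (\<forall>n. f n \<subseteq> f (Suc n))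
        \<longrightarrow> (\<exists>N. \<forall>m\<ge>N. f m = f N))"

definition k_ideal :: "'a::comm_semiring_1 set \<Rightarrow> bool" where
  "k_ideal I \<longleftrightarrow> sr_ideal I \<and> (\<forall>x y. x + y \<in> I \<and> x \<in> I \<longrightarrow> y \<in> I)"

definition sr_radical :: "'a::comm_semiring_1 set \<Rightarrow> 'a set" where
  "sr_radical I = {a. \<exists>n\<ge>1. a ^ n \<in> I}"

definition primary_ideal :: "'a::comm_semiring_1 set \<Rightarrow> bool" where
  "primary_ideal Q \<longleftrightarrow> sr_ideal Q \<and> Q \<noteq> UNIV \<and>
     (\<forall>x y. x * y \<in> Q \<longrightarrow> x \<in> Q \<or> y \<in> sr_radical Q)"

text \<open>Reduced primary decomposition Q_0,...,Q_{n-1}; the empty intersection is UNIV (= R).\<close>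
definition reduced_primary_decomposition :: "'a::comm_semiring_1 set \<Rightarrow> nat \<Rightarrow> (nat \<Rightarrow> 'a set) \<Rightarrow> bool" where
  "reduced_primary_decomposition I n Q \<longleftrightarrow>
     (\<forall>i<n. primary_ideal (Q i)) \<and>
     I = (\<Inter>i<n. Q i) \<and>
     (\<forall>i<n. \<forall>j<n. i \<noteq> j \<longrightarrow> sr_radical (Q i) \<noteq> sr_radical (Q j)) \<and>
     (\<forall>J. J \<subset> {..<n} \<longrightarrow> (\<Inter>i\<in>J. Q i) \<noteq> I)"

end

theory Submission
  imports Defs
begin

text \<open>
  Noetherian induction on \<open>k\<close>-ideals: a proper \<open>k\<close>-ideal \<open>I\<close> is written as \<open>Q \<inter> K\<close> with \<open>Q\<close> primary
  and \<open>K\<close> a strictly larger \<open>k\<close>-ideal. Let \<open>P\<close> be maximal among the ideals \<open>(I : x)\<close>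
  with \<open>x \<notin> I\<close>; it is prime, and \<open>K = (I : P)\<close>. The classical argument for irreducible ideals
  breaks down because the sum of \<open>I\<close> and a principal ideal need not be a \<open>k\<close>-ideal. But subtraction
  modulo \<open>I\<close> is available in \<open>V = {a. \<exists>b. a + b \<in> I}\<close>: if \<open>W\<close> is a \<open>k\<close>-ideal containing \<open>I\<close> and
  maximal with \<open>W \<inter> K \<subseteq> I\<close>, then every \<open>g \<in> P\<close> has a power with \<open>g\<^sup>n V \<subseteq> W\<close>. If a sum
  of elements lies in \<open>K\<close>, then \<open>P\<close> multiplies each summand into \<open>V\<close>, so summands divisible by a high power
  of some \<open>g \<in> P\<close> lie in \<open>W\<close>. Hence there is an ideal \<open>A \<supseteq> I\<close> containing a power of
  each element of \<open>P\<close> with \<open>A \<inter> K \<subseteq> W \<inter> K \<subseteq> I\<close>, and \<open>Q\<close> is the saturation of \<open>A\<close> with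
  respect to the complement of \<open>P\<close>.
\<close>

section \<open>Elementary properties of ideals and \<open>k\<close>-ideals\<close>

lemma sr_idealI:
  assumes "0 \<in> I" "\<And>x y. x \<in> I \<Longrightarrow> y \<in> I \<Longrightarrow> x + y \<in> I" "\<And>r x. x \<in> I \<Longrightarrow> r * x \<in> I"
  shows "sr_ideal (I :: 'a::comm_semiring_1 set)"
proof -
  have "x * r \<in> I" if "x \<in> I" for r x
    using assms(3)[OF that, of r] by (simp add: mult.commute)
  then show ?thesis
    unfolding sr_ideal_def using assms by blast
qed

lemma sr_ideal_add: "sr_ideal I \<Longrightarrow> x \<in> I \<Longrightarrow> y \<in> I \<Longrightarrow> x + y \<in> I"
  unfolding sr_ideal_def by blast

lemma sr_ideal_mult: "sr_ideal I \<Longrightarrow> x \<in> I \<Longrightarrow> r * x \<in> I"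
  unfolding sr_ideal_def by blast

lemma sr_ideal_zero: "sr_ideal I \<Longrightarrow> 0 \<in> I"
  unfolding sr_ideal_def by (metis all_not_in_conv mult_zero_left)

lemma k_ideal_ideal: "k_ideal I \<Longrightarrow> sr_ideal I"
  unfolding k_ideal_def by blast

lemma k_ideal_cancel: "k_ideal I \<Longrightarrow> x + y \<in> I \<Longrightarrow> x \<in> I \<Longrightarrow> y \<in> I"
  unfolding k_ideal_def by blast

lemma k_idealI:
  assumes "0 \<in> I" "\<And>x y. x \<in> I \<Longrightarrow> y \<in> I \<Longrightarrow> x + y \<in> I" "\<And>r x. x \<in> I \<Longrightarrow> r * x \<in> I"
    "\<And>x y. x + y \<in> I \<Longrightarrow> x \<in> I \<Longrightarrow> y \<in> I"
  shows "k_ideal (I :: 'a::comm_semiring_1 set)"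
  unfolding k_ideal_def using sr_idealI[OF assms(1-3)] assms(4) by blast

lemma primary_ideal_ideal: "primary_ideal Q \<Longrightarrow> sr_ideal Q"
  unfolding primary_ideal_def by blast

section \<open>Consequences of the ascending chain condition\<close>

lemma noetherian_chain_stable:
  fixes f :: "nat \<Rightarrow> 'a::comm_semiring_1 set"
  assumes "noetherian_semiring TYPE('a)" "\<And>n. sr_ideal (f n)" "\<And>n. f n \<subseteq> f (Suc n)"
  shows "\<exists>N. \<forall>m\<ge>N. f m = f N"
proof -
  have "(\<forall>n. sr_ideal (f n)) \<and> (\<forall>n. f n \<subseteq> f (Suc n)) \<longrightarrow> (\<exists>N. \<forall>m\<ge>N. f m = f N)"
    using assms(1) unfolding noetherian_semiring_def by (rule spec)
  then show ?thesis
    using assms(2,3) by simp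
qed

lemma noetherian_maximal:
  fixes S :: "'a::comm_semiring_1 set set"
  assumes noeth: "noetherian_semiring TYPE('a)"
    and ideals: "\<And>J. J \<in> S \<Longrightarrow> sr_ideal J"
    and ne: "I \<in> S"
  obtains M where "M \<in> S" "\<And>J. J \<in> S \<Longrightarrow> M \<subseteq> J \<Longrightarrow> J = M"
proof -
  have "\<exists>M\<in>S. \<forall>J\<in>S. M \<subseteq> J \<longrightarrow> J = M"
  proof (rule ccontr)
    assume "\<not> ?thesis"
    then have step: "\<exists>J. J \<in> S \<and> M \<subset> J" if "M \<in> S" for M
      using that by blast
    have "\<exists>f. \<forall>n. f n \<in> S \<and> f n \<subset> f (Suc n)"
      by (rule dependent_nat_choice) (use ne step in auto)
    then obtain f :: "nat \<Rightarrow> 'a set" where f: "\<And>n. f n \<in> S" and less: "\<And>n. f n \<subset> f (Suc n)"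
      by blast
    obtain N where N: "\<forall>m\<ge>N. f m = f N"
      using noetherian_chain_stable[of f, OF noeth ideals[OF f] psubset_imp_subset[OF less]] ..
    have "f (Suc N) = f N" by (rule N[rule_format]) simp
    then show False
      using less[of N] by simp
  qed
  then show thesis
    using that by blast
qed

text \<open>The ideals \<open>(J : g^n)\<close> ascend with \<open>n\<close>, so one of them
  contains all the others.\<close>

lemma noetherian_power_stable:
  fixes J :: "'a::comm_semiring_1 set"
  assumes noeth: "noetherian_semiring TYPE('a)" and J: "sr_ideal J"
  obtains n where "\<And>m v. g ^ m * v \<in> J \<Longrightarrow> g ^ n * v \<in> J"
proof -
  define f where "f n = {v. g ^ n * v \<in> J}" for n
  have f_ideal: "sr_ideal (f n)" for n
    unfolding f_def
  proof (rule sr_idealI)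
    show "r * v \<in> {v. g ^ n * v \<in> J}" if "v \<in> {v. g ^ n * v \<in> J}" for r v
      using that sr_ideal_mult[OF J, of "g ^ n * v" r] by (simp add: mult.left_commute)
  qed (auto simp: sr_ideal_zero[OF J] distrib_left sr_ideal_add[OF J])
  have mono: "f n \<subseteq> f (Suc n)" for n
    unfolding f_def using sr_ideal_mult[OF J] by (auto simp: mult.assoc)
  obtain N where N: "\<forall>m\<ge>N. f m = f N"
    using noetherian_chain_stable[of f, OF noeth f_ideal mono] ..
  have "f m \<subseteq> f N" for m
    using lift_Suc_mono_le[of f, OF mono] N by (metis nat_le_linear order_refl)
  then show thesis
    using that unfolding f_def by blast
qed

section \<open>Splitting a primary ideal off a \<open>k\<close>-ideal\<close>

lemma ideal_add_principal:
  fixes A :: "'a::comm_semiring_1 set"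
  assumes A: "sr_ideal A"
  shows "sr_ideal {a + r * c | a r. a \<in> A}"
proof (rule sr_idealI)
  show "0 \<in> {a + r * c | a r. a \<in> A}"
    using sr_ideal_zero[OF A] by (auto intro!: exI[of _ 0])
next
  fix x y assume "x \<in> {a + r * c | a r. a \<in> A}" "y \<in> {a + r * c | a r. a \<in> A}"
  then obtain a r b s where "x = a + r * c" "y = b + s * c" "a \<in> A" "b \<in> A"
    by blast
  then have "x + y = (a + b) + (r + s) * c" "a + b \<in> A"
    using sr_ideal_add[OF A] by (auto simp: algebra_simps)
  then show "x + y \<in> {a + r * c | a r. a \<in> A}"
    by blast
next
  fix t x assume "x \<in> {a + r * c | a r. a \<in> A}"
  then obtain a r where "x = a + r * c" "a \<in> A"
    by blast
  then have "t * x = t * a + (t * r) * c" "t * a \<in> A"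
    using sr_ideal_mult[OF A] by (auto simp: algebra_simps)
  then show "t * x \<in> {a + r * c | a r. a \<in> A}"
    by blast
qed

lemma k_ideal_decomposition_step:
  fixes I :: "'a::comm_semiring_1 set"
  assumes noeth: "noetherian_semiring TYPE('a)"
    and kI: "k_ideal I" and proper: "I \<noteq> UNIV"
  obtains Q K where "primary_ideal Q" "k_ideal K" "I \<subset> K" "I = Q \<inter> K"
proof -
  note iI = k_ideal_ideal[OF kI]
  define ann where "ann x = {r. r * x \<in> I}" for x
  have ann_ideal: "sr_ideal (ann x)" for x
    unfolding ann_def
    by (rule sr_idealI)
      (auto simp: sr_ideal_zero[OF iI] distrib_right sr_ideal_add[OF iI] sr_ideal_mult[OF iI] mult.assoc)
  obtain x0 where "x0 \<notin> I"
    using proper by blast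
  then obtain P where "P \<in> {ann x | x. x \<notin> I}"
    and Pmax: "\<And>J. J \<in> {ann x | x. x \<notin> I} \<Longrightarrow> P \<subseteq> J \<Longrightarrow> J = P"
    using noetherian_maximal[OF noeth, of "{ann x | x. x \<notin> I}" "ann x0"] ann_ideal by blast
  then obtain x where x: "x \<notin> I" and P: "P = ann x"
    by blast
  have annP: "ann y = P" if "y \<notin> I" "P \<subseteq> ann y" for y
    using Pmax that by blast
  \<comment> \<open>If \<open>b * x\<close> is not in \<open>I\<close>, then
    \<open>(I : b * x)\<close> contains \<open>P = (I : x)\<close>, so the two agree by maximality;
    \<open>a * b \<in> P\<close> then forces \<open>a \<in> P\<close>.\<close>
  have prime: "a * b \<notin> P" if "a \<notin> P" "b \<notin> P" for a b
  proof
    assume ab: "a * b \<in> P"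
    have "b * x \<notin> I" using that unfolding P ann_def by simp
    moreover have "P \<subseteq> ann (b * x)"
    proof
      fix r assume "r \<in> P"
      then have "b * (r * x) \<in> I" unfolding P ann_def using sr_ideal_mult[OF iI] by blast
      then show "r \<in> ann (b * x)" unfolding ann_def by (simp add: mult.left_commute)
    qed
    ultimately have "ann (b * x) = P" by (rule annP)
    moreover have "a \<in> ann (b * x)" using ab unfolding P ann_def by (simp add: mult.assoc)
    ultimately show False using that by blast
  qed
  have one: "1 \<notin> P" using x unfolding P ann_def by simp

  define K where "K = {z. \<forall>g\<in>P. g * z \<in> I}"
  have kK: "k_ideal K"
  proof (rule k_idealI)
    show "r * a \<in> K" if "a \<in> K" for r a
      unfolding K_def
    proof (intro CollectI ballI)
      fix g assume "g \<in> P"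
      then have "r * (g * a) \<in> I" using \<open>a \<in> K\<close> sr_ideal_mult[OF iI] unfolding K_def by blast
      then show "g * (r * a) \<in> I" by (simp add: mult.left_commute)
    qed
    show "b \<in> K" if "a + b \<in> K" "a \<in> K" for a b
      using that k_ideal_cancel[OF kI] unfolding K_def by (auto simp: distrib_left)
  qed (auto simp: K_def sr_ideal_zero[OF iI] distrib_left sr_ideal_add[OF iI])
  have IK: "I \<subseteq> K" unfolding K_def using sr_ideal_mult[OF iI] by blast
  have xK: "x \<in> K" unfolding K_def P ann_def by blast
  \<comment> \<open>Each element of \<open>K\<close> outside \<open>I\<close> has annihilator
    exactly \<open>P\<close> modulo \<open>I\<close>. At the end this cancels the multiplier that
    defines the saturation.\<close>
  have K_ann: "s \<in> P" if "z \<in> K" "z \<notin> I" "s * z \<in> I" for s z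
  proof -
    have "P \<subseteq> ann z" using that unfolding K_def ann_def by blast
    with that(2) have "ann z = P" by (rule annP)
    then show ?thesis using that unfolding ann_def by blast
  qed

  define V where "V = {a. \<exists>b. a + b \<in> I}"
  \<comment> \<open>If \<open>c\<close> is a complement of \<open>a + b\<close> modulo
    \<open>I\<close>, then \<open>b + c\<close> is one of \<open>a\<close>. So \<open>V\<close> is
    closed under taking summands, which is more than being a \<open>k\<close>-ideal.\<close>
  have V_left: "a \<in> V" if "a + b \<in> V" for a b
    using that unfolding V_def by (auto simp: add.assoc)
  have V_right: "b \<in> V" if "a + b \<in> V" for a b
    using V_left[of b a] that by (simp add: add.commute)
  have IV: "I \<subseteq> V" unfolding V_def by (auto intro: exI[of _ 0])
  have iV: "sr_ideal V"
  proof (rule sr_idealI)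
    show "0 \<in> V" using IV sr_ideal_zero[OF iI] by blast
  next
    fix a b assume "a \<in> V" "b \<in> V"
    then obtain c d where "a + c \<in> I" "b + d \<in> I" unfolding V_def by blast
    then have "(a + c) + (b + d) \<in> I" by (rule sr_ideal_add[OF iI])
    then have "(a + b) + (c + d) \<in> I" by (simp add: ac_simps)
    then show "a + b \<in> V" unfolding V_def by blast
  next
    fix r a assume "a \<in> V"
    then obtain c where "a + c \<in> I" unfolding V_def by blast
    then have "r * a + r * c \<in> I" using sr_ideal_mult[OF iI] by (metis distrib_left)
    then show "r * a \<in> V" unfolding V_def by blast
  qed

  obtain W where "W \<in> {W. k_ideal W \<and> I \<subseteq> W \<and> W \<inter> K \<subseteq> I}"
    and Wmax': "\<And>J. J \<in> {W. k_ideal W \<and> I \<subseteq> W \<and> W \<inter> K \<subseteq> I} \<Longrightarrow> W \<subseteq> J \<Longrightarrow> J = W"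
    using noetherian_maximal[OF noeth, of "{W. k_ideal W \<and> I \<subseteq> W \<and> W \<inter> K \<subseteq> I}" I]
      kI k_ideal_ideal by blast
  then have kW: "k_ideal W" and IW: "I \<subseteq> W" and WK: "W \<inter> K \<subseteq> I"
    by auto
  have Wmax: "J = W" if "k_ideal J" "W \<subseteq> J" "J \<inter> K \<subseteq> I" for J
    using Wmax' that IW by blast
  note iW = k_ideal_ideal[OF kW]

  have VW: "\<exists>n. \<forall>v\<in>V. g ^ n * v \<in> W" if g: "g \<in> P" for g
  proof -
    obtain n where n: "\<And>m v. g ^ m * v \<in> W \<Longrightarrow> g ^ n * v \<in> W"
      using noetherian_power_stable[OF noeth iW] by blast
    \<comment> \<open>\<open>W'\<close> consists of the elements that some member of
      \<open>g ^ n * V\<close> moves into \<open>W\<close>; the aim is \<open>W' = W\<close> by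
      maximality of \<open>W\<close>.\<close>
    define W' where "W' = {b. \<exists>v\<in>V. b + g ^ n * v \<in> W}"
    have W'I: "b \<in> W'" if "v \<in> V" "b + g ^ n * v \<in> W" for b v
      using that unfolding W'_def by blast
    have "W \<subseteq> W'"
      using W'I[of 0] sr_ideal_zero[OF iV] by auto
    moreover have "W' \<inter> K \<subseteq> I"
    proof
      fix z assume z: "z \<in> W' \<inter> K"
      then obtain v where v: "z + g ^ n * v \<in> W" unfolding W'_def by blast
      \<comment> \<open>Multiplication by \<open>g\<close> sends \<open>z\<close> into
        \<open>I\<close>, so the other summand \<open>g ^ Suc n * v\<close> lies in
        \<open>W\<close>, and the stable exponent lowers its power to \<open>n\<close>.\<close>
      then have "g * z + g ^ Suc n * v \<in> W"
        using sr_ideal_mult[OF iW v, of g] by (simp add: distrib_left mult.assoc)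
      moreover have "g * z \<in> W" using z g IW unfolding K_def by blast
      ultimately have "g ^ n * v \<in> W" using k_ideal_cancel[OF kW] n by blast
      then have "z \<in> W" using v k_ideal_cancel[OF kW] by (metis add.commute)
      then show "z \<in> I" using WK z by blast
    qed
    moreover have "k_ideal W'"
    proof (rule k_idealI)
      show "0 \<in> W'" using \<open>W \<subseteq> W'\<close> sr_ideal_zero[OF iW] by blast
    next
      fix a b assume "a \<in> W'" "b \<in> W'"
      then obtain u v where uv: "u \<in> V" "v \<in> V" "a + g ^ n * u \<in> W" "b + g ^ n * v \<in> W"
        unfolding W'_def by blast
      then have "(a + g ^ n * u) + (b + g ^ n * v) \<in> W" using sr_ideal_add[OF iW] by blast
      then have "(a + b) + g ^ n * (u + v) \<in> W" by (simp add: algebra_simps)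
      then show "a + b \<in> W'" using W'I sr_ideal_add[OF iV] uv by blast
    next
      fix r a assume "a \<in> W'"
      then obtain u where u: "u \<in> V" "a + g ^ n * u \<in> W" unfolding W'_def by blast
      then have "r * (a + g ^ n * u) \<in> W" using sr_ideal_mult[OF iW] by blast
      then have "r * a + g ^ n * (r * u) \<in> W" by (simp add: algebra_simps)
      then show "r * a \<in> W'" using W'I sr_ideal_mult[OF iV] u by blast
    next
      fix a b assume "a + b \<in> W'" "a \<in> W'"
      then obtain u v where uv: "u \<in> V" "v \<in> V" "a + b + g ^ n * u \<in> W" "a + g ^ n * v \<in> W"
        unfolding W'_def by blast
      \<comment> \<open>The complement \<open>v'\<close> replaces the missing negative of
        \<open>v\<close>: adding \<open>g ^ n * (v + v')\<close> makes \<open>a + g ^ n * v\<close>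
        appear as a summand that can be cancelled.\<close>
      then obtain v' where v': "v + v' \<in> I" unfolding V_def by blast
      then have "v' \<in> V" using V_right IV by blast
      have "g ^ n * (v + v') \<in> W" using v' IW sr_ideal_mult[OF iW] by blast
      then have "(a + b + g ^ n * u) + g ^ n * (v + v') \<in> W"
        using uv sr_ideal_add[OF iW] by blast
      then have "(a + g ^ n * v) + (b + g ^ n * (u + v')) \<in> W"
        by (simp add: algebra_simps)
      then have "b + g ^ n * (u + v') \<in> W"
        using uv k_ideal_cancel[OF kW] by blast
      then show "b \<in> W'" using W'I sr_ideal_add[OF iV] uv \<open>v' \<in> V\<close> by blast
    qed
    ultimately have "W' = W" using Wmax by blast
    have "g ^ n * v \<in> W" if v: "v \<in> V" for v
    proof -
      obtain v' where v': "v + v' \<in> I" using v unfolding V_def by blast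
      then have "v' \<in> V" using V_right IV by blast
      moreover have "g ^ n * v + g ^ n * v' \<in> W"
        using v' IW sr_ideal_mult[OF iW] by (metis distrib_left subsetD)
      ultimately show ?thesis using W'I \<open>W' = W\<close> by blast
    qed
    then show ?thesis by blast
  qed

  have high_power: "\<exists>N. \<forall>r. g * (r * g ^ N) \<in> V \<longrightarrow> r * g ^ N \<in> W" if g: "g \<in> P" for g
  proof -
    obtain n where n: "\<forall>v\<in>V. g ^ n * v \<in> W" using VW[OF g] by blast
    obtain m where m: "\<And>k v. g ^ k * v \<in> V \<Longrightarrow> g ^ m * v \<in> V"
      using noetherian_power_stable[OF noeth iV] by blast
    \<comment> \<open>The exponent \<open>m\<close> serves to remain in \<open>V\<close> once
      surplus powers of \<open>g\<close> are removed, and the further factor \<open>g ^ n\<close>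
      carries \<open>V\<close> into \<open>W\<close>.\<close>
    have "r * g ^ (n + m) \<in> W" if "g * (r * g ^ (n + m)) \<in> V" for r
    proof -
      have "g ^ Suc (n + m) * r \<in> V" using that by (simp add: ac_simps)
      then have "g ^ m * r \<in> V" by (rule m)
      then have "g ^ n * (g ^ m * r) \<in> W" using n by blast
      then show ?thesis by (simp add: power_add ac_simps)
    qed
    then show ?thesis by blast
  qed

  \<comment> \<open>The last clause says that members of \<open>A\<close> which are summands of
    elements of \<open>K\<close> lie in \<open>W\<close>. Allowing a remainder \<open>b\<close>,
    instead of only bounding \<open>A \<inter> K\<close>, is what lets new generators be adjoined
    without subtraction.\<close>
  define good where "good A \<longleftrightarrow> sr_ideal A \<and> I \<subseteq> A \<and>
      (\<forall>a\<in>A. \<forall>b. (\<forall>g\<in>P. g * (a + b) \<in> I) \<longrightarrow> a \<in> W)" for A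
  have good_ideal: "sr_ideal A" if "good A" for A using that unfolding good_def by blast
  have "good I" unfolding good_def using iI IW by blast
  then obtain A where A: "good A" and Amax: "\<And>J. good J \<Longrightarrow> A \<subseteq> J \<Longrightarrow> J = A"
    using noetherian_maximal[OF noeth, of "{A. good A}" I] good_ideal
    unfolding mem_Collect_eq by blast
  have iA: "sr_ideal A" and IA: "I \<subseteq> A"
    and AW: "\<And>a b. a \<in> A \<Longrightarrow> (\<And>g. g \<in> P \<Longrightarrow> g * (a + b) \<in> I) \<Longrightarrow> a \<in> W"
    using A unfolding good_def by blast+
  have AK: "a \<in> I" if "a \<in> A" "a \<in> K" for a
    using AW[of a 0] that WK unfolding K_def by auto
  have P_power: "\<exists>N. g ^ N \<in> A" if g: "g \<in> P" for g
  proof -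
    obtain N where N: "\<forall>r. g * (r * g ^ N) \<in> V \<longrightarrow> r * g ^ N \<in> W"
      using high_power[OF g] by blast
    define A' where "A' = {a + r * g ^ N | a r. a \<in> A}"
    have AA': "A \<subseteq> A'"
    proof
      fix a assume "a \<in> A"
      moreover have "a = a + 0 * g ^ N" by simp
      ultimately show "a \<in> A'" unfolding A'_def by blast
    qed
    have "good A'"
      unfolding good_def
    proof (intro conjI ballI allI impI)
      show "sr_ideal A'" unfolding A'_def by (rule ideal_add_principal[OF iA])
      show "I \<subseteq> A'" using IA AA' by blast
    next
      fix c b assume "c \<in> A'" and cb: "\<forall>h\<in>P. h * (c + b) \<in> I"
      then obtain a r where c: "c = a + r * g ^ N" and a: "a \<in> A" unfolding A'_def by blast
      \<comment> \<open>Both \<open>a\<close> and \<open>r * g ^ N\<close> are summands of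
        \<open>c + b \<in> K\<close>: the first is handled by goodness of \<open>A\<close>, the
        second by the choice of \<open>N\<close>.\<close>
      have "a \<in> W"
        by (rule AW[OF a, of "r * g ^ N + b"]) (use cb c in \<open>simp add: add.assoc\<close>)
      moreover have "g * (a + r * g ^ N + b) \<in> I"
        using cb g c by blast
      then have "g * (r * g ^ N) + g * (a + b) \<in> I"
        by (simp add: algebra_simps)
      then have "r * g ^ N \<in> W" using N IV V_left by blast
      ultimately show "c \<in> W" unfolding c by (rule sr_ideal_add[OF iW])
    qed
    then have "A' = A" using Amax AA' by blast
    moreover have "0 + 1 * g ^ N \<in> A'" unfolding A'_def using sr_ideal_zero[OF iA] by blast
    ultimately show ?thesis by auto
  qed

  define Q where "Q = {a. \<exists>s. s \<notin> P \<and> s * a \<in> A}"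
  have AQ: "A \<subseteq> Q" unfolding Q_def using one by (auto intro: exI[of _ 1])
  have "primary_ideal Q"
    unfolding primary_ideal_def
  proof (intro conjI allI impI)
    show "sr_ideal Q"
    proof (rule sr_idealI)
      show "0 \<in> Q" using AQ sr_ideal_zero[OF iA] by blast
    next
      fix a b assume "a \<in> Q" "b \<in> Q"
      then obtain s t where st: "s \<notin> P" "t \<notin> P" "s * a \<in> A" "t * b \<in> A" unfolding Q_def by blast
      then have "t * (s * a) + s * (t * b) \<in> A" using sr_ideal_mult[OF iA] sr_ideal_add[OF iA] by blast
      then have "(s * t) * (a + b) \<in> A" by (simp add: algebra_simps)
      then show "a + b \<in> Q" unfolding Q_def using prime st by blast
    next
      fix r a assume "a \<in> Q"
      then obtain s where s: "s \<notin> P" "s * a \<in> A" unfolding Q_def by blast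
      then have "s * (r * a) \<in> A" using sr_ideal_mult[OF iA] by (metis mult.left_commute)
      then show "r * a \<in> Q" unfolding Q_def using s by blast
    qed
  next
    have "1 \<notin> Q"
    proof
      assume "1 \<in> Q"
      then obtain s where s: "s \<notin> P" "s \<in> A" unfolding Q_def by auto
      \<comment> \<open>The product \<open>s * x\<close> lies in \<open>A \<inter> K\<close>, hence
        in \<open>I\<close>, which would put \<open>s\<close> into
        \<open>(I : x) = P\<close>.\<close>
      have "x * s \<in> A" using s sr_ideal_mult[OF iA] by blast
      moreover have "s * x \<in> K" using xK sr_ideal_mult[OF k_ideal_ideal[OF kK]] by blast
      ultimately have "s * x \<in> I" using AK by (metis mult.commute)
      then show False using s unfolding P ann_def by blast
    qed
    then show "Q \<noteq> UNIV" by blast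
  next
    fix a b assume "a * b \<in> Q"
    then obtain s where s: "s \<notin> P" "s * (a * b) \<in> A" unfolding Q_def by blast
    \<comment> \<open>Elements of \<open>P\<close> have a power in \<open>A\<close>; elements
      outside \<open>P\<close> are absorbed into the multiplier \<open>s\<close>, since
      \<open>P\<close> is prime.\<close>
    show "a \<in> Q \<or> b \<in> sr_radical Q"
    proof (cases "b \<in> P")
      case True
      then obtain N where "b ^ N \<in> A" using P_power by blast
      \<comment> \<open>The successor ensures the positive exponent that the radical
        demands.\<close>
      then have "b ^ Suc N \<in> A" using sr_ideal_mult[OF iA] by simp
      then have "b ^ Suc N \<in> Q" using AQ by blast
      then have "b \<in> sr_radical Q" unfolding sr_radical_def by (auto intro!: exI[of _ "Suc N"])
      then show ?thesis ..
    next
      case False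
      have "(s * b) * a \<in> A" using s by (simp add: ac_simps)
      then have "a \<in> Q" unfolding Q_def using prime[OF s(1) False] by blast
      then show ?thesis ..
    qed
  qed
  moreover have "I \<subset> K" using IK x xK by blast
  moreover have "I = Q \<inter> K"
  proof
    show "I \<subseteq> Q \<inter> K" using IA AQ IK by blast
    show "Q \<inter> K \<subseteq> I"
    proof
      fix a assume a: "a \<in> Q \<inter> K"
      then obtain s where s: "s \<notin> P" "s * a \<in> A" unfolding Q_def by blast
      have "s * a \<in> I" using AK s a sr_ideal_mult[OF k_ideal_ideal[OF kK]] by blast
      then show "a \<in> I" using K_ann s a by blast
    qed
  qed
  ultimately show thesis using that kK by blast
qed

section \<open>Existence of a finite primary decomposition\<close>

lemma k_ideal_finite_primary_decomposition:
  fixes I :: "'a::comm_semiring_1 set"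
  assumes noeth: "noetherian_semiring TYPE('a)" and kI: "k_ideal I"
  shows "\<exists>F. finite F \<and> (\<forall>Q\<in>F. primary_ideal Q) \<and> I = \<Inter>F"
proof (rule ccontr)
  define decomp where
    "decomp J \<longleftrightarrow> (\<exists>F. finite F \<and> (\<forall>Q\<in>F. primary_ideal Q) \<and> J = \<Inter>F)" for J :: "'a set"
  assume "\<not> ?thesis"
  then have "\<not> decomp I" unfolding decomp_def .
  then obtain M where M: "k_ideal M" "\<not> decomp M"
    and Mmax: "\<And>J. k_ideal J \<Longrightarrow> \<not> decomp J \<Longrightarrow> M \<subseteq> J \<Longrightarrow> J = M"
    using noetherian_maximal[OF noeth, of "{J. k_ideal J \<and> \<not> decomp J}" I] kI k_ideal_ideal
    unfolding mem_Collect_eq by metis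
  have "decomp UNIV" unfolding decomp_def by (auto intro!: exI[of _ "{}"])
  then have "M \<noteq> UNIV" using M by blast
  then obtain Q K where QK: "primary_ideal Q" "k_ideal K" "M \<subset> K" "M = Q \<inter> K"
    using k_ideal_decomposition_step[OF noeth M(1)] by blast
  then have "decomp K" using Mmax by blast
  then obtain F where "finite F" "\<forall>Q\<in>F. primary_ideal Q" "K = \<Inter>F" unfolding decomp_def by blast
  then have "decomp M"
    unfolding decomp_def using QK by (auto intro!: exI[of _ "insert Q F"])
  then show False using M by blast
qed

section \<open>Merging components and passing to a reduced decomposition\<close>

lemma sr_radical_Int:
  fixes I J :: "'a::comm_semiring_1 set"
  assumes "sr_ideal I" "sr_ideal J"
  shows "sr_radical (I \<inter> J) = sr_radical I \<inter> sr_radical J"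
proof
  show "sr_radical (I \<inter> J) \<subseteq> sr_radical I \<inter> sr_radical J"
    unfolding sr_radical_def by blast
  show "sr_radical I \<inter> sr_radical J \<subseteq> sr_radical (I \<inter> J)"
  proof
    fix a assume "a \<in> sr_radical I \<inter> sr_radical J"
    then obtain m n where mn: "m \<ge> 1" "a ^ m \<in> I" "a ^ n \<in> J" unfolding sr_radical_def by blast
    then have "a ^ n * a ^ m \<in> I" "a ^ m * a ^ n \<in> J"
      using sr_ideal_mult assms by blast+
    then have "a ^ (m + n) \<in> I \<inter> J" by (simp add: power_add mult.commute)
    then show "a \<in> sr_radical (I \<inter> J)" unfolding sr_radical_def using mn(1)
      by (auto intro!: exI[of _ "m + n"])
  qed
qed

text \<open>If \<open>x * y\<close> lies in both ideals and \<open>x\<close> misses one of them,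
  then \<open>y\<close> lies in the common radical, which is also the radical of the
  intersection.\<close>

lemma primary_ideal_Int:
  fixes Q Q' :: "'a::comm_semiring_1 set"
  assumes Q: "primary_ideal Q" and Q': "primary_ideal Q'" and rad: "sr_radical Q = sr_radical Q'"
  shows "primary_ideal (Q \<inter> Q')"
proof -
  note i = primary_ideal_ideal[OF Q] primary_ideal_ideal[OF Q']
  have "sr_ideal (Q \<inter> Q')"
    by (rule sr_idealI) (use i sr_ideal_zero sr_ideal_add sr_ideal_mult in blast)+
  then show ?thesis
    using Q Q' rad sr_radical_Int[OF i] unfolding primary_ideal_def by blast
qed

theorem theorem2p7:
  fixes I :: "'a::comm_semiring_1 set"
  assumes "noetherian_semiring TYPE('a)"
    and "k_ideal I"
  shows "\<exists>n Q. reduced_primary_decomposition I n Q"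
proof -
  define decomposes where
    "decomposes F \<longleftrightarrow> finite F \<and> (\<forall>Q\<in>F. primary_ideal Q) \<and> I = \<Inter>F" for F
  have "\<exists>F. decomposes F"
    using k_ideal_finite_primary_decomposition[OF assms] unfolding decomposes_def .
  \<comment> \<open>A decomposing family of least cardinality is already reduced: dropping members,
    or merging two with the same radical, would give a smaller one.\<close>
  then obtain F where F: "decomposes F" and Fmin: "\<And>G. decomposes G \<Longrightarrow> card F \<le> card G"
    by (metis arg_min_natI arg_min_nat_le)
  then have fin: "finite F" and prim: "\<And>Q. Q \<in> F \<Longrightarrow> primary_ideal Q" and I: "I = \<Inter>F"
    unfolding decomposes_def by auto
  have no_sub: "\<Inter>G \<noteq> I" if "G \<subset> F" for G
  proof
    assume "\<Inter>G = I"
    then have "decomposes G"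
      unfolding decomposes_def using that fin prim finite_subset by blast
    then show False using Fmin psubset_card_mono[OF fin that] by fastforce
  qed
  have rad: "sr_radical Q \<noteq> sr_radical Q'" if Q: "Q \<in> F" "Q' \<in> F" "Q \<noteq> Q'" for Q Q'
  proof
    assume "sr_radical Q = sr_radical Q'"
    then have "primary_ideal (Q \<inter> Q')" using primary_ideal_Int prim Q by blast
    moreover have "\<Inter>(insert (Q \<inter> Q') (F - {Q, Q'})) = \<Inter>F" using Q by blast
    ultimately have "decomposes (insert (Q \<inter> Q') (F - {Q, Q'}))"
      unfolding decomposes_def using fin prim I by auto
    then have "card F \<le> card (insert (Q \<inter> Q') (F - {Q, Q'}))" by (rule Fmin)
    also have "\<dots> \<le> Suc (card (F - {Q, Q'}))" by (rule card_insert_le_m1) auto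
    also have "card (F - {Q, Q'}) = card F - 2" using Q fin by (simp add: card_Diff_subset)
    finally show False using card_mono[OF fin, of "{Q, Q'}"] Q by simp
  qed
  \<comment> \<open>Injectivity of the enumeration makes proper index subsets correspond to proper
    subfamilies of \<open>F\<close>.\<close>
  obtain q where q: "bij_betw q {..<card F} F"
    using ex_bij_betw_nat_finite[OF fin] by (auto simp: atLeast0LessThan)
  then have qF: "q ` {..<card F} = F" and inj: "inj_on q {..<card F}"
    by (auto simp: bij_betw_def)
  have "reduced_primary_decomposition I (card F) q"
    unfolding reduced_primary_decomposition_def
  proof (intro conjI allI impI)
    show "primary_ideal (q i)" if "i < card F" for i using prim qF that by blast
    show "I = (\<Inter>i<card F. q i)" using I qF by simp
    show "sr_radical (q i) \<noteq> sr_radical (q j)" if "i < card F" "j < card F" "i \<noteq> j" for i j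
    proof (rule rad)
      show "q i \<in> F" "q j \<in> F" using qF that by blast+
      show "q i \<noteq> q j" using inj_onD[OF inj] that by blast
    qed
    show "(\<Inter>i\<in>J. q i) \<noteq> I" if "J \<subset> {..<card F}" for J
      using no_sub image_strict_mono[OF inj that] qF by simp
  qed
  then show ?thesis by blast
qed

end
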